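(* Let $n=2$, let $\varphi$ be a function of $p=\{p_1,p_2\}$, and let $\gamma^0>0$ and $\omega$ be constants. Consider, in the coordinates $(x,p,z)$ of the $5$-dimensional contact manifold $(\mathcal{C},\lambda=dz-p_a\,dx^a)$, the dynamical system $$\frac{d\Delta^a}{dt}=-\frac{\partial F_b}{\partial p_a}\Delta^b-\frac{d\Gamma}{d\Delta^0}\Delta^a,\qquad \frac{dp_a}{dt}=F_a(p),\qquad \frac{d\Delta^0}{dt}=-\Gamma(\Delta^0)$$ with $$F_1(p_1,p_2)=\omega p_2,\qquad F_2(p_1,p_2)=-\omega p_1,\qquad \Gamma(\Delta^0)=\gamma^0\Delta^0 .$$ Then the flow asymptotically approaches the embedded Legendre submanifold $\mathcal{A}_\varphi^{\mathcal{C}}$.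
   Context: Everything is smooth; repeated indices are summed over $1,2$. Here $\Delta^0=x^jp_j-\varphi(p)-z$ and $\Delta^a=x^a-\frac{\partial\varphi}{\partial p_a}(p)$, so that the system is a system of ODEs for $(x,p,z)$ (it is the flow of the contact Hamiltonian vector field of $h=\Delta^aF_a+\Gamma(\Delta^0)$). The embedded Legendre submanifold generated by $-\varphi$ is $\mathcal{A}_\varphi^{\mathcal{C}}=\{\Delta^0=\Delta^1=\Delta^2=0\}=\{x^a=\partial\varphi/\partial p_a,\ z=p_i\,\partial\varphi/\partial p_i-\varphi(p)\}$. "The flow asymptotically approaches $\mathcal{A}_\varphi^{\mathcal{C}}$" means that along every solution $(x(t),p(t),z(t))$, $t\ge0$, one has $\lim_{t\to\infty}\Delta^0(t)=\lim_{t\to\infty}\Delta^1(t)=\lim_{t\to\infty}\Delta^2(t)=0$. *)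

theory Defs
  imports "HOL-Analysis.Analysis"
begin

definition partial :: "'n::finite \<Rightarrow> (real^'n \<Rightarrow> real) \<Rightarrow> real^'n \<Rightarrow> real"
  where "partial a f p = deriv (\<lambda>s. f (p + s *\<^sub>R axis a 1)) 0"

primrec Ck :: "nat \<Rightarrow> (real^'n::finite \<Rightarrow> real) \<Rightarrow> bool" where
  "Ck 0 f \<longleftrightarrow> continuous_on UNIV f"
| "Ck (Suc k) f \<longleftrightarrow> f differentiable_on UNIV \<and> (\<forall>a. Ck k (partial a f))"

definition smooth :: "(real^'n::finite \<Rightarrow> real) \<Rightarrow> bool"
  where "smooth f \<longleftrightarrow> (\<forall>k. Ck k f)"

text \<open>Points of the contact manifold are given by their coordinates \<open>(x, p, z)\<close>.\<close>

type_synonym 'n contact = "(real^'n) \<times> (real^'n) \<times> real"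

definition p_coord :: "'n::finite contact \<Rightarrow> real^'n"
  where "p_coord = (\<lambda>(x, p, z). p)"

definition Delta0 :: "(real^'n::finite \<Rightarrow> real) \<Rightarrow> 'n contact \<Rightarrow> real"
  where "Delta0 \<phi> = (\<lambda>(x, p, z). (\<Sum>j\<in>UNIV. x $ j * p $ j) - \<phi> p - z)"

definition Delta :: "(real^'n::finite \<Rightarrow> real) \<Rightarrow> 'n \<Rightarrow> 'n contact \<Rightarrow> real"
  where "Delta \<phi> a = (\<lambda>(x, p, z). x $ a - partial a \<phi> p)"

text \<open>The embedded Legendre submanifold generated by \<open>-\<phi>\<close>.\<close>

definition legendre :: "(real^'n::finite \<Rightarrow> real) \<Rightarrow> 'n contact set"
  where "legendre \<phi> = {c. Delta0 \<phi> c = 0 \<and> (\<forall>a. Delta \<phi> a c = 0)}"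

lemma legendre_eq:
  "legendre \<phi> = {(x, p, z). (\<forall>a. x $ a = partial a \<phi> p) \<and>
                            z = (\<Sum>i\<in>UNIV. p $ i * partial i \<phi> p) - \<phi> p}"
  by (auto simp: legendre_def Delta0_def Delta_def mult.commute)

text \<open>
  Solutions on \<open>t \<ge> 0\<close>. The unknown is the curve \<open>c(t) = (x(t), p(t), z(t))\<close>; the time
  derivatives of \<open>\<Delta>\<close> are taken along it (one-sided at \<open>t = 0\<close>).
\<close>

definition is_solution ::
  "(real^'n::finite \<Rightarrow> real) \<Rightarrow> ('n \<Rightarrow> real^'n \<Rightarrow> real) \<Rightarrow> (real \<Rightarrow> real) \<Rightarrow> (real \<Rightarrow> 'n contact) \<Rightarrow> bool"
  where "is_solution \<phi> F \<Gamma> c \<longleftrightarrow>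
    c differentiable_on {0..} \<and>
    (\<forall>t\<ge>0.
      (\<forall>a. ((\<lambda>s. Delta \<phi> a (c s)) has_real_derivative
              - (\<Sum>b\<in>UNIV. partial a (F b) (p_coord (c t)) * Delta \<phi> b (c t))
              - deriv \<Gamma> (Delta0 \<phi> (c t)) * Delta \<phi> a (c t)) (at t within {0..})) \<and>
      (\<forall>a. ((\<lambda>s. p_coord (c s) $ a) has_real_derivative F a (p_coord (c t))) (at t within {0..})) \<and>
      ((\<lambda>s. Delta0 \<phi> (c s)) has_real_derivative - \<Gamma> (Delta0 \<phi> (c t))) (at t within {0..}))"

text \<open>
  The flow approaches \<open>legendre \<phi>\<close> in the sense that its defining functions tend to \<open>0\<close> along every
  solution; this is not a statement about the distance to the set.
\<close>

definition flow_approaches_legendre ::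
  "(real^'n::finite \<Rightarrow> real) \<Rightarrow> ('n \<Rightarrow> real^'n \<Rightarrow> real) \<Rightarrow> (real \<Rightarrow> real) \<Rightarrow> bool"
  where "flow_approaches_legendre \<phi> F \<Gamma> \<longleftrightarrow>
    (\<forall>c. is_solution \<phi> F \<Gamma> c \<longrightarrow>
      ((\<lambda>t. Delta0 \<phi> (c t)) \<longlongrightarrow> 0) at_top \<and>
      (\<forall>a. ((\<lambda>t. Delta \<phi> a (c t)) \<longlongrightarrow> 0) at_top))"

end

theory Submission
  imports Defs "HOL-Real_Asymp.Real_Asymp"
begin

text \<open>
  The equation for \<open>\<Delta>\<^sup>0\<close> is linear decay. The Jacobian of \<open>F\<close> is antisymmetric, so its contribution
  to the derivative of \<open>E = (\<Delta>\<^sup>1)\<^sup>2 + (\<Delta>\<^sup>2)\<^sup>2\<close> cancels and \<open>E\<close> satisfies \<open>E' = -2 \<gamma>0 E\<close>.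
\<close>

text \<open>The integrating factor \<open>exp (k * t)\<close> turns the equation into a vanishing
  derivative, so \<open>f t = C * exp (- (k * t))\<close> on the half-line. The derivative is
  one-sided at 0, as in \<open>is_solution\<close>.\<close>

lemma linear_decay_tendsto_0:
  fixes f :: "real \<Rightarrow> real"
  assumes "k > 0"
    and deriv: "\<And>t. t \<ge> 0 \<Longrightarrow> (f has_real_derivative - k * f t) (at t within {0..})"
  shows "(f \<longlongrightarrow> 0) at_top"
proof -
  have "((\<lambda>s. f s * exp (k * s)) has_real_derivative 0) (at t within {0..})" if "t \<in> {0..}" for t
    using deriv[of t] that
    by (auto intro!: derivative_eq_intros simp: algebra_simps)
  from has_field_derivative_zero_constant[OF convex_real_interval(1) this]
  obtain C where C: "\<And>t. t \<in> {0..} \<Longrightarrow> f t * exp (k * t) = C"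
    by blast
  have "((\<lambda>t. C * exp (- (k * t))) \<longlongrightarrow> 0) at_top"
    using \<open>k > 0\<close> by real_asymp
  \<comment> \<open>Nothing is known about \<open>f\<close> at negative times, so the closed form
    holds only eventually.\<close>
  moreover have "\<forall>\<^sub>F t in at_top. C * exp (- (k * t)) = f t"
    using eventually_ge_at_top[of 0]
  proof eventually_elim
    case (elim t)
    then show ?case
      using C[of t] by (auto simp: exp_minus field_simps)
  qed
  ultimately show ?thesis
    by (simp add: tendsto_cong)
qed

lemma partial_linear_coord:
  "partial a (\<lambda>p. k * p $ b) p = (if a = b then k else 0)"
proof -
  have "((\<lambda>s. k * (p + s *\<^sub>R axis a 1) $ b) has_real_derivative (if a = b then k else 0)) (at 0)"
    by (auto simp: axis_def intro!: derivative_eq_intros)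
  then show ?thesis
    unfolding partial_def by (rule DERIV_imp_deriv)
qed

text \<open>Both \<open>\<bar>f t\<bar>\<close> and \<open>\<bar>g t\<bar>\<close> are bounded by
  the Euclidean norm of the pair.\<close>

lemma tendsto_0_of_sum_squares:
  fixes f g :: "'a \<Rightarrow> real"
  assumes "((\<lambda>t. (f t)\<^sup>2 + (g t)\<^sup>2) \<longlongrightarrow> 0) A"
  shows "(f \<longlongrightarrow> 0) A" and "(g \<longlongrightarrow> 0) A"
proof -
  have lim: "((\<lambda>t. sqrt ((f t)\<^sup>2 + (g t)\<^sup>2)) \<longlongrightarrow> 0) A"
    using tendsto_real_sqrt[OF assms] by simp
  show "(f \<longlongrightarrow> 0) A" "(g \<longlongrightarrow> 0) A"
    by (rule Lim_null_comparison[OF _ lim], simp)+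
qed

theorem theorem4p6:
  fixes \<phi> :: "real^2 \<Rightarrow> real"
    and F :: "2 \<Rightarrow> real^2 \<Rightarrow> real"
    and \<Gamma> :: "real \<Rightarrow> real"
    and \<gamma>0 \<omega> :: real
  assumes "smooth \<phi>"
    and "\<gamma>0 > 0"
    and "\<And>p. F 1 p = \<omega> * p $ 2"
    and "\<And>p. F 2 p = - \<omega> * p $ 1"
    and "\<And>d. \<Gamma> d = \<gamma>0 * d"
  shows "flow_approaches_legendre \<phi> F \<Gamma>"
  unfolding flow_approaches_legendre_def
proof (intro allI impI)
  fix c assume sol: "is_solution \<phi> F \<Gamma> c"
  \<comment> \<open>Equalities of functions, not just of values, allow rewriting under
    \<open>partial\<close> and \<open>deriv\<close>.\<close>
  have F: "F 1 = (\<lambda>p. \<omega> * p $ 2)" "F 2 = (\<lambda>p. - \<omega> * p $ 1)" and \<Gamma>: "\<Gamma> = (\<lambda>d. \<gamma>0 * d)"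
    using assms(3-5) by auto
  have deriv_\<Gamma>: "deriv \<Gamma> d = \<gamma>0" for d
    unfolding \<Gamma> by (rule DERIV_imp_deriv) (auto intro!: derivative_eq_intros)
  define D where "D = (\<lambda>a t. Delta \<phi> a (c t))"
  have D: "(D a has_real_derivative
      - (\<Sum>b\<in>UNIV. partial a (F b) (p_coord (c t)) * D b t) - \<gamma>0 * D a t) (at t within {0..})"
    if "t \<ge> 0" for a t
    using sol that unfolding is_solution_def D_def deriv_\<Gamma> by blast
  \<comment> \<open>The sum runs over the components of \<open>F\<close>, differentiated in
    direction \<open>a\<close>. Only \<open>F 2\<close> depends on \<open>p $ 1\<close>, with slope
    \<open>- \<omega>\<close>, and only \<open>F 1\<close> on \<open>p $ 2\<close>, with slope
    \<open>\<omega>\<close>; the minus sign in front of the sum flips both.\<close>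
  have D1: "(D 1 has_real_derivative \<omega> * D 2 t - \<gamma>0 * D 1 t) (at t within {0..})"
    and D2: "(D 2 has_real_derivative - \<omega> * D 1 t - \<gamma>0 * D 2 t) (at t within {0..})"
    if "t \<ge> 0" for t
    using D[OF that, of 1] D[OF that, of 2] unfolding sum_2 F partial_linear_coord by simp_all
  have "((\<lambda>t. (D 1 t)\<^sup>2 + (D 2 t)\<^sup>2) has_real_derivative
      - (2 * \<gamma>0) * ((D 1 t)\<^sup>2 + (D 2 t)\<^sup>2)) (at t within {0..})" if "t \<ge> 0" for t
    using that by (auto intro!: derivative_eq_intros D1 D2 simp: algebra_simps power2_eq_square)
  then have "((\<lambda>t. (D 1 t)\<^sup>2 + (D 2 t)\<^sup>2) \<longlongrightarrow> 0) at_top"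
    using \<open>\<gamma>0 > 0\<close> by (intro linear_decay_tendsto_0[of "2 * \<gamma>0"]) auto
  from tendsto_0_of_sum_squares[OF this] have "(D a \<longlongrightarrow> 0) at_top" for a
    using exhaust_2[of a] by auto
  moreover have "((\<lambda>t. Delta0 \<phi> (c t)) \<longlongrightarrow> 0) at_top"
    \<comment> \<open>The chained fact fixes the decay rate as \<open>k = \<gamma>0\<close>.\<close>
    using \<open>\<gamma>0 > 0\<close>
  proof (rule linear_decay_tendsto_0)
    fix t :: real assume "t \<ge> 0"
    then show "((\<lambda>t. Delta0 \<phi> (c t)) has_real_derivative - \<gamma>0 * Delta0 \<phi> (c t)) (at t within {0..})"
      using sol by (simp add: is_solution_def \<Gamma>)
  qed
  ultimately show "((\<lambda>t. Delta0 \<phi> (c t)) \<longlongrightarrow> 0) at_top \<and>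
      (\<forall>a. ((\<lambda>t. Delta \<phi> a (c t)) \<longlongrightarrow> 0) at_top)"
    by (simp add: D_def)
qed

end
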